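(* Let $T_n$ be an infinite model tree with root $x_0$, branching numbers $n(r)$, and heat kernel $\rho_t(x,y)$; write $\rho_t(r)=\rho_t(x_0,x)$ for $x\in S_r(x_0)$ (this depends only on $r$). Let $G$ be an infinite, locally finite, connected graph without loops or multiple edges, with heat kernel $p_t(x,y)$. 1) If $G$ contains a vertex $x_0'$ such that, for all $r\ge 0$ and all $x\in S_r(x_0')\subset G$, $m_{+1}(x)\le n(r)$, then $$\rho_t(r)\le p_t(x_0',x)\quad\text{for all } r\ge 0,\ x\in S_r(x_0')\subset G,\ t\ge 0.$$ 2) If $G$ contains a vertex $x_0'$ such that $n(r)\le m_{+1}(x)$ for all $r\ge 0$ and all $x\in S_r(x_0')\subset G$, and $m_{-1}(x)=1$ for all $r\ge1$ and all $x\in S_r(x_0')\subset G$, then $$p_t(x_0',x)\le\rho_t(r)\quad\text{for all } r\ge 0,\ x\in S_r(x_0')\subset G,\ t\ge 0.$$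
   Context: $d(x,y)$ is the number of edges in a shortest path from $x$ to $y$; $S_r(o)$ is the set of vertices at distance exactly $r$ from $o$. For $x\in S_r(x_0')\subset G$, $m_{\pm1}(x)=|\{y\sim x: y\in S_{r\pm1}(x_0')\}|$ is the number of neighbors of $x$ in the next (respectively previous) sphere about $x_0'$. A model tree $T_n$ is an infinite, locally finite, connected tree containing a vertex $x_0$ (the root) such that the valence $m(x)$ of any other vertex $x$ depends only on $r=d(x,x_0)$; write $m(x)=m(r)$. Its branching number is $n(0)=m(x_0)$ and $n(r)=m(r)-1$ for $r>0$. For an infinite, locally finite, connected graph with vertex set $V$: Laplacian: $\Delta f(x)=\sum_{y\sim x}(f(x)-f(y))$ for $f:V\to\mathbf{R}$. Heat kernel: fix a vertex $o\in V$. For $r\ge 0$ let $B_r$ be the subgraph induced on the vertices at distance at most $r$ from $o$; $\mathrm{int}\,B_r$ is the set of vertices of $B_r$ all of whose neighbors in the graph lie in $B_r$, and $\partial B_r$ is the set of remaining vertices of $B_r$. Let $C(B_r,\partial B_r)$ be the finite-dimensional space of real functions on $B_r$ vanishing on $\partial B_r$, and let $\Delta_r$ act on it by $\Delta_r f(x)=\Delta f(x)$ for $x\in \mathrm{int}\,B_r$ and $\Delta_r f(x)=0$ for $x \in \partial B_r$. For $t\ge 0$ put $p_t^r(x,y)=e^{-t\Delta_r}\delta_x(y)$ for $x,y\in\mathrm{int}\,B_r$ and $p_t^r(x,y)=0$ for all other pairs of vertices. The heat kernel is $p_t(x,y)=\lim_{r\to\infty}p_t^r(x,y)$ (the limit exists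 and does not depend on $o$). Equivalently, $p_t(x,y)$ is the smallest non-negative function satisfying $\Delta p_t(x,y)+\frac{\partial}{\partial t}p_t(x,y)=0$ for $t \geq 0$ and $p_0(x,y)=\delta_x(y)$. *)

theory Defs
  imports Complex_Main
begin

record 'a graph =
  verts :: "'a set"
  adj :: "'a \<Rightarrow> 'a \<Rightarrow> bool"

definition simple_graph :: "'a graph \<Rightarrow> bool" where
  "simple_graph G \<longleftrightarrow>
     (\<forall>x y. adj G x y \<longrightarrow> x \<in> verts G \<and> y \<in> verts G) \<and>
     (\<forall>x y. adj G x y \<longrightarrow> adj G y x) \<and>
     (\<forall>x. \<not> adj G x x)"

definition locally_finite :: "'a graph \<Rightarrow> bool" where
  "locally_finite G \<longleftrightarrow> (\<forall>x\<in>verts G. finite {y. adj G x y})"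

definition connected_graph :: "'a graph \<Rightarrow> bool" where
  "connected_graph G \<longleftrightarrow> (\<forall>x\<in>verts G. \<forall>y\<in>verts G. (adj G)\<^sup>*\<^sup>* x y)"

definition valence :: "'a graph \<Rightarrow> 'a \<Rightarrow> nat" where
  "valence G x = card {y. adj G x y}"

text \<open>The relational power \<open>(adj G ^^ n) x y\<close> says that there is a walk with \<open>n\<close> edges from
  \<open>x\<close> to \<open>y\<close>; a shortest walk is a shortest path. The value is meaningful for vertices of a
  connected graph only.\<close>

definition gdist :: "'a graph \<Rightarrow> 'a \<Rightarrow> 'a \<Rightarrow> nat" where
  "gdist G x y = (LEAST n. (adj G ^^ n) x y)"

definition gsphere :: "'a graph \<Rightarrow> 'a \<Rightarrow> nat \<Rightarrow> 'a set" where
  "gsphere G c r = {x \<in> verts G. gdist G c x = r}"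

definition m_plus :: "'a graph \<Rightarrow> 'a \<Rightarrow> 'a \<Rightarrow> nat" where
  "m_plus G c x = card {y. adj G x y \<and> y \<in> gsphere G c (gdist G c x + 1)}"

text \<open>Only used for \<open>x \<noteq> c\<close>, so that the subtraction is not truncated.\<close>

definition m_minus :: "'a graph \<Rightarrow> 'a \<Rightarrow> 'a \<Rightarrow> nat" where
  "m_minus G c x = card {y. adj G x y \<and> y \<in> gsphere G c (gdist G c x - 1)}"

definition is_cycle :: "'a graph \<Rightarrow> 'a list \<Rightarrow> bool" where
  "is_cycle G xs \<longleftrightarrow>
     3 \<le> length xs \<and> distinct xs \<and> successively (adj G) xs \<and> adj G (last xs) (hd xs)"

definition is_tree :: "'a graph \<Rightarrow> bool" where
  "is_tree G \<longleftrightarrow> simple_graph G \<and> connected_graph G \<and> (\<nexists>xs. is_cycle G xs)"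

definition model_tree :: "'a graph \<Rightarrow> 'a \<Rightarrow> bool" where
  "model_tree T x0 \<longleftrightarrow>
     is_tree T \<and> infinite (verts T) \<and> locally_finite T \<and> x0 \<in> verts T \<and>
     (\<forall>x\<in>verts T - {x0}. \<forall>y\<in>verts T - {x0}.
        gdist T x0 x = gdist T x0 y \<longrightarrow> valence T x = valence T y)"

text \<open>In a model tree every sphere about the root is nonempty and the valence is constant on it,
  so the description is proper.\<close>

definition valence_at :: "'a graph \<Rightarrow> 'a \<Rightarrow> nat \<Rightarrow> nat" where
  "valence_at T x0 r = (THE m. \<forall>x\<in>gsphere T x0 r. valence T x = m)"

text \<open>By connectedness \<open>valence_at T x0 r\<close> is at least 1 for \<open>r > 0\<close>, so the subtraction is not
  truncated.\<close>

definition branching :: "'a graph \<Rightarrow> 'a \<Rightarrow> nat \<Rightarrow> nat" where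
  "branching T x0 r = (if r = 0 then valence T x0 else valence_at T x0 r - 1)"

definition laplacian :: "'a graph \<Rightarrow> ('a \<Rightarrow> real) \<Rightarrow> 'a \<Rightarrow> real" where
  "laplacian G f x = (\<Sum>y | adj G x y. f x - f y)"

definition gball :: "'a graph \<Rightarrow> 'a \<Rightarrow> nat \<Rightarrow> 'a set" where
  "gball G c r = {x \<in> verts G. gdist G c x \<le> r}"

definition int_gball :: "'a graph \<Rightarrow> 'a \<Rightarrow> nat \<Rightarrow> 'a set" where
  "int_gball G c r = {x \<in> gball G c r. \<forall>y. adj G x y \<longrightarrow> y \<in> gball G c r}"

text \<open>A function on the ball vanishing on its boundary is identified with its extension by zero,
  i.e. with a function that vanishes outside \<open>int_gball G c r\<close>. The operator below preserves the
  space of these functions.\<close>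

definition dirichlet_laplacian :: "'a graph \<Rightarrow> 'a \<Rightarrow> nat \<Rightarrow> ('a \<Rightarrow> real) \<Rightarrow> 'a \<Rightarrow> real" where
  "dirichlet_laplacian G c r f x = (if x \<in> int_gball G c r then laplacian G f x else 0)"

text \<open>The exponential series of a linear operator on functions, evaluated pointwise. It is applied
  only to operators on the finite-dimensional spaces just described, where pointwise convergence
  is convergence in norm.\<close>

definition exp_op :: "(('a \<Rightarrow> real) \<Rightarrow> ('a \<Rightarrow> real)) \<Rightarrow> ('a \<Rightarrow> real) \<Rightarrow> 'a \<Rightarrow> real" where
  "exp_op A f y = (\<Sum>k. (A ^^ k) f y / fact k)"

definition dirichlet_kernel :: "'a graph \<Rightarrow> 'a \<Rightarrow> nat \<Rightarrow> real \<Rightarrow> 'a \<Rightarrow> 'a \<Rightarrow> real" where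
  "dirichlet_kernel G c r t x y =
     (if x \<in> int_gball G c r \<and> y \<in> int_gball G c r
      then exp_op (\<lambda>f z. - t * dirichlet_laplacian G c r f z) (\<lambda>z. of_bool (z = x)) y
      else 0)"

text \<open>The center \<open>c\<close> of the exhausting balls is a parameter because the definition mentions it; the
  value does not depend on the choice of \<open>c\<close>.\<close>

definition heat_kernel :: "'a graph \<Rightarrow> 'a \<Rightarrow> real \<Rightarrow> 'a \<Rightarrow> 'a \<Rightarrow> real" where
  "heat_kernel G c t x y = lim (\<lambda>r. dirichlet_kernel G c r t x y)"

end

theory Submission
  imports Defs
begin

text \<open>
  Both inequalities compare the heat flow from the root of the tree, transplanted to \<open>G\<close> along
  the distance from \<open>x0'\<close>, with the heat flow of \<open>G\<close>. Write \<open>u r\<close> for the value of the tree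
  flow at distance \<open>r\<close>. On \<open>G\<close> the Laplacian of \<open>u (d x)\<close> at a vertex with \<open>d x = r\<close> is
  \<open>m_plus * (u r - u (r + 1)) + m_minus * (u r - u (r - 1))\<close>, since neighbours at the same
  distance cancel; on the tree the two coefficients are \<open>n r\<close> and \<open>1\<close>. As \<open>u\<close> decreases in \<open>r\<close>,
  the first difference is nonnegative and the second nonpositive. So if \<open>m_plus \<le> n r\<close> (and
  \<open>m_minus \<ge> 1\<close>, which always holds off the root), the transplanted flow is a subsolution of
  the heat equation on \<open>G\<close>, and if \<open>m_plus \<ge> n r\<close> and \<open>m_minus = 1\<close> it is a supersolution. The
  maximum principle gives the two inequalities.

  The maximum principle takes a discrete form. For a finite set \<open>D\<close> of vertices and a
  constant \<open>M\<close> that bounds the valences on \<open>D\<close>, put \<open>J = M - \<Delta>\<close>, with \<open>\<Delta>\<close> the Laplacian killed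
  outside \<open>D\<close>. Then \<open>J\<close> is monotone, and \<open>exp (-t \<Delta>) = exp (-t M) exp (t J)\<close> expands the kernel
  into a series in the iterates \<open>J^k \<delta>\<close> with nonnegative coefficients (\<open>sums_killed_kernel\<close>).
  Every comparison of kernels thus reduces to a comparison of iterates, proved by induction
  on \<open>k\<close>; monotonicity of \<open>J\<close> plays the part of the maximum principle. This yields in turn
  that the killed kernels grow with \<open>D\<close>, so that the heat kernel is their supremum over all
  finite \<open>D\<close> and any exhaustion may be used (\<open>killed_kernel_le_heat_kernel\<close>, \<open>heat_kernel_le\<close>); that
  the radial profile decreases (\<open>radial_iter_antimono\<close>); and that it is a sub- or supersolution
  on balls (\<open>radial_iter_le_shifted_iter\<close>, \<open>shifted_iter_le_radial_iter\<close>).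

  The tree satisfies both sets of hypotheses with respect to its own branching numbers, so
  each inequality of the theorem is an instance of one statement about two rooted graphs,
  \<open>heat_kernel_compare\<close>, with the radial profile in between. What is special about trees enters only
  through the values of \<open>m_plus\<close> and \<open>m_minus\<close>: without cycles, a vertex has at most one neighbour
  that is not farther from the root (\<open>nbr_not_farther_unique\<close>).
\<close>

section \<open>Killed kernels on finite sets of vertices\<close>

text \<open>Balls about different centers, and their interiors, are all treated as finite sets \<open>D\<close>
  of vertices, so that kernels of different exhaustions can be compared.\<close>

definition killed_laplacian :: "'a graph \<Rightarrow> 'a set \<Rightarrow> ('a \<Rightarrow> real) \<Rightarrow> 'a \<Rightarrow> real" where
  "killed_laplacian G D f x = (if x \<in> D then laplacian G f x else 0)"

definition killed_kernel :: "'a graph \<Rightarrow> 'a set \<Rightarrow> real \<Rightarrow> 'a \<Rightarrow> 'a \<Rightarrow> real" where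
  "killed_kernel G D t x y =
     (if x \<in> D \<and> y \<in> D
      then exp_op (\<lambda>f z. - t * killed_laplacian G D f z) (\<lambda>z. of_bool (z = x)) y
      else 0)"

lemma dirichlet_kernel_eq_killed_kernel:
  "dirichlet_kernel G c r t x y = killed_kernel G (int_gball G c r) t x y"
proof -
  have "dirichlet_laplacian G c r = killed_laplacian G (int_gball G c r)"
    by (intro ext) (simp add: dirichlet_laplacian_def killed_laplacian_def)
  then show ?thesis by (simp add: dirichlet_kernel_def killed_kernel_def)
qed

text \<open>The operator \<open>J = M - \<Delta>\<close>. Its matrix has nonnegative entries once \<open>M\<close> bounds the valences
  on \<open>D\<close>.\<close>

definition shifted :: "'a graph \<Rightarrow> 'a set \<Rightarrow> real \<Rightarrow> ('a \<Rightarrow> real) \<Rightarrow> 'a \<Rightarrow> real" where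
  "shifted G D M f x = M * f x - killed_laplacian G D f x"

definition shifted_iter :: "'a graph \<Rightarrow> 'a set \<Rightarrow> real \<Rightarrow> 'a \<Rightarrow> nat \<Rightarrow> 'a \<Rightarrow> real" where
  "shifted_iter G D M x k = (shifted G D M ^^ k) (\<lambda>z. of_bool (z = x))"

lemma shifted_iter_0: "shifted_iter G D M x 0 y = of_bool (y = x)"
  by (simp add: shifted_iter_def)

lemma shifted_iter_Suc: "shifted_iter G D M x (Suc k) = shifted G D M (shifted_iter G D M x k)"
  by (simp add: shifted_iter_def)

lemma laplacian_eq: "laplacian G f x = real (valence G x) * f x - (\<Sum>y | adj G x y. f y)"
  by (simp add: laplacian_def valence_def sum_subtractf)

lemma shifted_inside:
  "x \<in> D \<Longrightarrow> shifted G D M f x = (M - real (valence G x)) * f x + (\<Sum>y | adj G x y. f y)"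
  by (simp add: shifted_def killed_laplacian_def laplacian_eq algebra_simps)

lemma shifted_outside: "x \<notin> D \<Longrightarrow> shifted G D M f x = M * f x"
  by (simp add: shifted_def killed_laplacian_def)

lemma laplacian_lincomb:
  "laplacian G (\<lambda>z. \<Sum>j\<in>J. a j * g j z) x = (\<Sum>j\<in>J. a j * laplacian G (g j) x)"
  by (simp add: laplacian_eq sum_distrib_left sum_subtractf right_diff_distrib
      sum.swap[where A = J] algebra_simps)

lemma killed_laplacian_lincomb:
  "killed_laplacian G D (\<lambda>z. \<Sum>j\<in>J. a j * g j z) x = (\<Sum>j\<in>J. a j * killed_laplacian G D (g j) x)"
  by (simp add: killed_laplacian_def laplacian_lincomb)

text \<open>The binomial theorem for \<open>-t \<Delta> = t J - t M\<close>, whose two summands commute because the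
  second is a scalar; the induction is Pascal's rule.\<close>

lemma funpow_killed_laplacian_binomial:
  fixes G :: "'a graph" and D :: "'a set" and t M :: real
  defines "B \<equiv> \<lambda>f z. - t * killed_laplacian G D f z"
  shows "(B ^^ k) f =
    (\<lambda>z. \<Sum>j\<le>k. (of_nat (k choose j) * (- t * M) ^ (k - j) * t ^ j) * (shifted G D M ^^ j) f z)"
proof (induction k)
  case 0
  show ?case by simp
next
  case (Suc k)
  define C where "C j = (shifted G D M ^^ j) f" for j
  define s where "s = - t * M"
  have step: "- t * killed_laplacian G D (C j) z = t * C (Suc j) z + s * C j z" for j z
    by (simp add: C_def s_def shifted_def algebra_simps)
  have IH: "(B ^^ k) f = (\<lambda>z. \<Sum>j\<le>k. (of_nat (k choose j) * s ^ (k - j) * t ^ j) * C j z)"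
    using Suc.IH by (simp add: C_def s_def)
  show ?case
  proof
    fix z
    have "(B ^^ Suc k) f z = B (\<lambda>z. \<Sum>j\<le>k. (of_nat (k choose j) * s ^ (k - j) * t ^ j) * C j z) z"
      using IH by simp
    also have "\<dots> = (\<Sum>j\<le>k. (of_nat (k choose j) * s ^ (k - j) * t ^ j)
        * (- t * killed_laplacian G D (C j) z))"
      unfolding B_def killed_laplacian_lincomb by (simp add: sum_distrib_left algebra_simps)
    also have "\<dots> = (\<Sum>j\<le>k. of_nat (k choose j) * s ^ (k - j) * t ^ Suc j * C (Suc j) z)
        + (\<Sum>j\<le>k. of_nat (k choose j) * s ^ (Suc k - j) * t ^ j * C j z)"
      unfolding step by (simp add: sum.distrib[symmetric] Suc_diff_le algebra_simps)
    also have "(\<Sum>j\<le>k. of_nat (k choose j) * s ^ (Suc k - j) * t ^ j * C j z)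
        = (\<Sum>j\<le>Suc k. of_nat (k choose j) * s ^ (Suc k - j) * t ^ j * C j z)"
      by simp
    also have "\<dots> = s ^ Suc k * C 0 z
        + (\<Sum>j\<le>k. of_nat (k choose Suc j) * s ^ (k - j) * t ^ Suc j * C (Suc j) z)"
      by (subst sum.atMost_Suc_shift) simp
    also have "(\<Sum>j\<le>k. of_nat (k choose j) * s ^ (k - j) * t ^ Suc j * C (Suc j) z) + \<dots>
        = s ^ Suc k * C 0 z
        + (\<Sum>j\<le>k. of_nat (Suc k choose Suc j) * s ^ (k - j) * t ^ Suc j * C (Suc j) z)"
      by (simp add: sum.distrib[symmetric] algebra_simps)
    also have "\<dots> = (\<Sum>j\<le>Suc k. of_nat (Suc k choose j) * s ^ (Suc k - j) * t ^ j * C j z)"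
      by (subst sum.atMost_Suc_shift) simp
    finally show "(B ^^ Suc k) f z = (\<Sum>j\<le>Suc k. (of_nat (Suc k choose j) * (- t * M) ^ (Suc k - j)
        * t ^ j) * (shifted G D M ^^ j) f z)"
      by (simp only: C_def s_def)
  qed
qed

lemma shifted_mono:
  assumes "\<And>z. z \<in> D \<Longrightarrow> real (valence G z) \<le> M" and "0 \<le> M"
    and "f x \<le> g x" and "\<And>y. adj G x y \<Longrightarrow> f y \<le> g y"
  shows "shifted G D M f x \<le> shifted G D M g x"
proof (cases "x \<in> D")
  case True
  then show ?thesis
    using assms by (auto simp: shifted_inside intro!: add_mono mult_left_mono sum_mono)
next
  case False
  then show ?thesis using assms by (simp add: shifted_outside mult_left_mono)
qed

lemma shifted_const: "shifted G D M (\<lambda>_. a) x = M * a"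
  by (simp add: shifted_def killed_laplacian_def laplacian_def)

text \<open>The constants \<open>0\<close> and \<open>M ^ k\<close> are carried along by the monotone operator, because \<open>J\<close>
  multiplies constant functions by \<open>M\<close>.\<close>

lemma shifted_iter_bounds:
  assumes "\<And>z. z \<in> D \<Longrightarrow> real (valence G z) \<le> M" and "0 \<le> M"
  shows "0 \<le> shifted_iter G D M x k y" and "shifted_iter G D M x k y \<le> M ^ k"
proof -
  have "0 \<le> shifted_iter G D M x k y \<and> shifted_iter G D M x k y \<le> M ^ k"
  proof (induction k arbitrary: y)
    case 0
    show ?case by (simp add: shifted_iter_0)
  next
    case (Suc k)
    show ?case
      using shifted_mono[where D = D and f = "\<lambda>_. 0" and g = "shifted_iter G D M x k" and x = y, OF assms]
        shifted_mono[where D = D and f = "shifted_iter G D M x k" and g = "\<lambda>_. M ^ k" and x = y, OF assms]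
        Suc.IH
      by (simp add: shifted_iter_Suc shifted_const)
  qed
  then show "0 \<le> shifted_iter G D M x k y" and "shifted_iter G D M x k y \<le> M ^ k" by auto
qed

lemma shifted_iter_outside:
  "x \<in> D \<Longrightarrow> y \<notin> D \<Longrightarrow> shifted_iter G D M x k y = 0"
  by (induction k) (auto simp: shifted_iter_0 shifted_iter_Suc shifted_outside)

text \<open>The exponential series of \<open>-t \<Delta>\<close> is the Cauchy product of those of \<open>t J\<close> and \<open>-t M\<close>. The
  weights \<open>t ^ k / fact k\<close> of the iterates are nonnegative, which is what turns inequalities
  between iterates into inequalities between kernels.\<close>

lemma sums_killed_kernel:
  assumes "\<And>z. z \<in> D \<Longrightarrow> real (valence G z) \<le> M" and "0 \<le> M" and "0 \<le> t"
    and "x \<in> D" and "y \<in> D"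
  shows "(\<lambda>k. t ^ k / fact k * shifted_iter G D M x k y) sums
           (exp (t * M) * killed_kernel G D t x y)"
proof -
  let ?a = "\<lambda>k. t ^ k / fact k * shifted_iter G D M x k y"
  let ?e = "\<lambda>k. (- t * M) ^ k / fact k"
  note bounds = shifted_iter_bounds[where D = D, OF assms(1,2)]
  have e_sums: "?e sums exp (- t * M)"
    using exp_converges[of "- t * M"] by (simp add: divide_inverse mult.commute)
  have e_abs: "summable (\<lambda>k. norm (?e k))"
    using summable_norm_exp[of "- t * M"] by (simp add: divide_inverse mult.commute)
  have M_summable: "summable (\<lambda>k. (t * M) ^ k / fact k)"
    using exp_converges[of "t * M"] by (auto simp: divide_inverse mult.commute sums_iff)
  have a_abs: "summable (\<lambda>k. norm (?a k))"
  proof (rule summable_comparison_test'[OF M_summable])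
    fix k
    show "norm (norm (?a k)) \<le> (t * M) ^ k / fact k"
      using bounds[of x k y] assms(3)
      by (simp add: abs_mult power_mult_distrib divide_right_mono mult_left_mono)
  qed
  have term_eq: "((\<lambda>f z. - t * killed_laplacian G D f z) ^^ k) (\<lambda>z. of_bool (z = x)) y / fact k
      = (\<Sum>j\<le>k. ?a j * ?e (k - j))" for k
    unfolding funpow_killed_laplacian_binomial[where M = M] sum_divide_distrib
    by (intro sum.cong refl)
      (simp add: binomial_fact shifted_iter_def field_simps)
  have "killed_kernel G D t x y = (\<Sum>k. \<Sum>j\<le>k. ?a j * ?e (k - j))"
    using assms(4,5) by (simp only: killed_kernel_def exp_op_def term_eq if_True simp_thms)
  also have "\<dots> = (\<Sum>k. ?a k) * exp (- t * M)"
    using Cauchy_product_sums[OF a_abs e_abs] e_sums by (simp add: sums_iff)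
  finally have "exp (t * M) * killed_kernel G D t x y = (\<Sum>k. ?a k)"
    by (simp add: exp_minus field_simps)
  then show ?thesis
    using summable_norm_cancel[OF a_abs] by (simp add: sums_iff)
qed

lemma killed_kernel_le:
  fixes G :: "'a graph" and H :: "'b graph"
  assumes "\<And>z. z \<in> D \<Longrightarrow> real (valence G z) \<le> M" and "\<And>z. z \<in> E \<Longrightarrow> real (valence H z) \<le> M"
    and "0 \<le> M" and "0 \<le> t" and "x \<in> D" and "y \<in> D" and "x' \<in> E" and "y' \<in> E"
    and "\<And>k. shifted_iter G D M x k y \<le> shifted_iter H E M x' k y'"
  shows "killed_kernel G D t x y \<le> killed_kernel H E t x' y'"
proof -
  have "exp (t * M) * killed_kernel G D t x y \<le> exp (t * M) * killed_kernel H E t x' y'"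
    by (rule sums_le[OF _ sums_killed_kernel sums_killed_kernel])
      (use assms in \<open>auto intro!: mult_left_mono divide_right_mono\<close>)
  then show ?thesis by simp
qed

lemma killed_kernel_bounds:
  assumes "finite D" and "0 \<le> t"
  shows "0 \<le> killed_kernel G D t x y" and "killed_kernel G D t x y \<le> 1"
proof -
  define M where "M = real (\<Sum>z\<in>D. valence G z)"
  have M: "real (valence G z) \<le> M" if "z \<in> D" for z
    unfolding M_def using assms(1) that by (simp add: member_le_sum del: of_nat_sum)
  have "0 \<le> M" by (simp add: M_def sum_nonneg)
  note bounds = shifted_iter_bounds[where D = D, OF M this]
  have "0 \<le> killed_kernel G D t x y \<and> killed_kernel G D t x y \<le> 1"
  proof (cases "x \<in> D \<and> y \<in> D")
    case True
    then have sums: "(\<lambda>k. t ^ k / fact k * shifted_iter G D M x k y) sums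
        (exp (t * M) * killed_kernel G D t x y)"
      using sums_killed_kernel[where D = D, OF M \<open>0 \<le> M\<close> assms(2)] by auto
    have "0 \<le> exp (t * M) * killed_kernel G D t x y"
      by (rule sums_le[OF _ sums_zero sums]) (use bounds(1) assms(2) in simp)
    moreover have "exp (t * M) * killed_kernel G D t x y \<le> exp (t * M)"
    proof (rule sums_le[OF _ sums])
      show "(\<lambda>k. (t * M) ^ k / fact k) sums exp (t * M)"
        using exp_converges[of "t * M"] by (simp add: divide_inverse mult.commute)
      show "t ^ k / fact k * shifted_iter G D M x k y \<le> (t * M) ^ k / fact k" for k
        using bounds(2)[of x k y] assms(2)
        by (simp add: power_mult_distrib divide_right_mono mult_left_mono)
    qed
    ultimately show ?thesis by (simp add: zero_le_mult_iff)
  next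
    case False
    then show ?thesis by (auto simp: killed_kernel_def)
  qed
  then show "0 \<le> killed_kernel G D t x y" and "killed_kernel G D t x y \<le> 1" by auto
qed

text \<open>Enlarging the domain only changes \<open>J f\<close> on the new vertices. There the iterates of the
  smaller domain vanish, while those of the larger one are nonnegative.\<close>

lemma shifted_iter_mono_domain:
  assumes "D \<subseteq> E" and "\<And>z. z \<in> E \<Longrightarrow> real (valence G z) \<le> M" and "0 \<le> M" and "x \<in> D"
  shows "shifted_iter G D M x k y \<le> shifted_iter G E M x k y"
proof (induction k arbitrary: y)
  case 0
  show ?case by (simp add: shifted_iter_0)
next
  case (Suc k)
  let ?f = "shifted_iter G D M x k"
  have D: "z \<in> D \<Longrightarrow> real (valence G z) \<le> M" for z using assms(1,2) by auto
  have "shifted G D M ?f y \<le> shifted G E M ?f y"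
  proof (cases "y \<in> E - D")
    case True
    have "0 \<le> shifted G E M ?f y"
      using shifted_mono[where D = E and f = "\<lambda>_. 0" and g = ?f and x = y, OF assms(2,3)]
        shifted_iter_bounds(1)[where D = D, OF D assms(3)]
      by (simp add: shifted_const)
    then show ?thesis
      using True assms(4) by (simp add: shifted_outside shifted_iter_outside)
  next
    case False
    then show ?thesis using assms(1) by (auto simp: shifted_def killed_laplacian_def)
  qed
  also have "\<dots> \<le> shifted G E M (shifted_iter G E M x k) y"
    by (rule shifted_mono) (use assms Suc.IH in auto)
  finally show ?case by (simp add: shifted_iter_Suc)
qed

lemma killed_kernel_mono_domain:
  assumes "D \<subseteq> E" and "finite E" and "0 \<le> t"
  shows "killed_kernel G D t x y \<le> killed_kernel G E t x y"
proof (cases "x \<in> D \<and> y \<in> D")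
  case True
  define M where "M = real (\<Sum>z\<in>E. valence G z)"
  have M: "real (valence G z) \<le> M" if "z \<in> E" for z
    unfolding M_def using assms(2) that by (simp add: member_le_sum del: of_nat_sum)
  have "0 \<le> M" by (simp add: M_def sum_nonneg)
  show ?thesis
    by (rule killed_kernel_le[where M = M])
      (use True M \<open>0 \<le> M\<close> assms shifted_iter_mono_domain[where E = E, OF assms(1) M] in auto)
next
  case False
  then have "killed_kernel G D t x y = 0" by (auto simp: killed_kernel_def)
  then show ?thesis using killed_kernel_bounds(1)[OF assms(2,3)] by simp
qed

section \<open>Distance from a root\<close>

locale rooted_graph =
  fixes G :: "'a graph" and c :: 'a
  assumes simple: "simple_graph G" and locally_finite: "locally_finite G"
    and connected: "connected_graph G" and root: "c \<in> verts G"
begin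

lemma adj_verts: "adj G x y \<Longrightarrow> x \<in> verts G" "adj G x y \<Longrightarrow> y \<in> verts G"
  using simple by (auto simp: simple_graph_def)

lemma adj_sym: "adj G x y \<Longrightarrow> adj G y x"
  using simple by (auto simp: simple_graph_def)

lemma adj_irrefl: "\<not> adj G x x"
  using simple by (auto simp: simple_graph_def)

lemma finite_nbrs: "finite {y. adj G x y}"
proof (cases "x \<in> verts G")
  case False
  then have "{y. adj G x y} = {}" using adj_verts by auto
  then show ?thesis by simp
qed (use locally_finite in \<open>auto simp: locally_finite_def\<close>)

lemma gdist_walk: "x \<in> verts G \<Longrightarrow> (adj G ^^ gdist G c x) c x"
  unfolding gdist_def
  by (rule LeastI_ex) (use connected root in \<open>auto simp: connected_graph_def intro: rtranclp_imp_relpowp\<close>)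

lemma gdist_le: "(adj G ^^ n) c x \<Longrightarrow> gdist G c x \<le> n"
  unfolding gdist_def by (rule Least_le)

lemma gdist_root: "gdist G c c = 0"
  using gdist_le[of 0 c] by simp

lemma gdist_eq_0_iff: "x \<in> verts G \<Longrightarrow> gdist G c x = 0 \<longleftrightarrow> x = c"
  using gdist_walk[of x] gdist_root by auto

lemma gdist_adj_le: "adj G x y \<Longrightarrow> gdist G c y \<le> Suc (gdist G c x)"
  using gdist_le[of "Suc (gdist G c x)" y] gdist_walk[of x] adj_verts by (meson relpowp_Suc_I)

lemma predecessor_exists:
  assumes "x \<in> verts G" and "x \<noteq> c"
  obtains y where "adj G x y" and "Suc (gdist G c y) = gdist G c x"
proof -
  obtain n where n: "gdist G c x = Suc n"
    using assms gdist_eq_0_iff by (metis not0_implies_Suc)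
  then have "(adj G ^^ Suc n) c x" using gdist_walk[OF assms(1)] by simp
  then obtain y where y: "(adj G ^^ n) c y" "adj G y x" by (rule relpowp_Suc_E)
  have "gdist G c y = n"
    using gdist_le[OF y(1)] gdist_adj_le[OF y(2)] n by simp
  then show ?thesis using that[of y] adj_sym[OF y(2)] n by simp
qed

lemma gdist_adj_cases:
  assumes "adj G x y"
  shows "gdist G c y = Suc (gdist G c x) \<or> gdist G c y = gdist G c x \<or>
    Suc (gdist G c y) = gdist G c x"
  using gdist_adj_le[OF assms] gdist_adj_le[OF adj_sym[OF assms]] by linarith

lemma m_plus_eq: "m_plus G c x = card {y. adj G x y \<and> gdist G c y = Suc (gdist G c x)}"
  unfolding m_plus_def gsphere_def using adj_verts by (intro arg_cong[where f = card]) auto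

text \<open>The formula extends to the root, where the subtraction in the definition of \<open>m_minus\<close>
  truncates: both sides are \<open>0\<close> there, because the sphere of radius \<open>0\<close> is the root alone and
  the root has no loop.\<close>

lemma m_minus_eq:
  assumes "x \<in> verts G"
  shows "m_minus G c x = card {y. adj G x y \<and> Suc (gdist G c y) = gdist G c x}"
proof -
  have "{y. adj G x y \<and> y \<in> gsphere G c (gdist G c x - 1)}
      = {y. adj G x y \<and> Suc (gdist G c y) = gdist G c x}"
  proof (cases "x = c")
    case True
    have "gdist G c y \<noteq> 0" if "adj G c y" for y
      using that adj_verts adj_irrefl gdist_eq_0_iff by metis
    then show ?thesis using True by (auto simp: gsphere_def gdist_root)
  next
    case False
    then have "gdist G c x \<noteq> 0" using assms gdist_eq_0_iff by simp
    then show ?thesis using adj_verts by (auto simp: gsphere_def)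
  qed
  then show ?thesis by (simp add: m_minus_def)
qed

lemma m_minus_pos:
  assumes "x \<in> verts G" and "x \<noteq> c"
  shows "1 \<le> m_minus G c x"
proof -
  obtain y where "adj G x y" "Suc (gdist G c y) = gdist G c x"
    using predecessor_exists[OF assms] .
  then have "{y. adj G x y \<and> Suc (gdist G c y) = gdist G c x} \<noteq> {}" by auto
  moreover have "finite {y. adj G x y \<and> Suc (gdist G c y) = gdist G c x}"
    by (rule finite_subset[OF _ finite_nbrs[of x]]) auto
  ultimately show ?thesis
    unfolding m_minus_eq[OF assms(1)] by (simp add: Suc_le_eq card_gt_0_iff)
qed

lemma laplacian_radial:
  fixes f :: "nat \<Rightarrow> real"
  assumes "x \<in> verts G"
  defines "r \<equiv> gdist G c x"
  shows "laplacian G (\<lambda>y. f (gdist G c y)) x =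
    real (m_plus G c x) * (f r - f (Suc r)) + real (m_minus G c x) * (f r - f (r - 1))"
proof -
  let ?P = "{y. adj G x y \<and> gdist G c y = Suc r}" and ?Z = "{y. adj G x y \<and> gdist G c y = r}"
    and ?N = "{y. adj G x y \<and> Suc (gdist G c y) = r}"
  have fin: "finite ?P" "finite ?Z" "finite ?N"
    by (rule finite_subset[OF _ finite_nbrs[of x]]; auto)+
  \<comment> \<open>The edges inside a sphere contribute nothing, since the function is constant there.\<close>
  have split: "{y. adj G x y} = ?P \<union> (?Z \<union> ?N)"
    using gdist_adj_cases[of x] by (auto simp: r_def)
  have "laplacian G (\<lambda>y. f (gdist G c y)) x = (\<Sum>y\<in>?P. f r - f (gdist G c y))
      + ((\<Sum>y\<in>?Z. f r - f (gdist G c y)) + (\<Sum>y\<in>?N. f r - f (gdist G c y)))"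
    unfolding laplacian_def split r_def[symmetric]
    by (subst sum.union_disjoint; (subst sum.union_disjoint)?; use fin in auto)
  also have "\<dots> = (\<Sum>y\<in>?P. f r - f (Suc r)) + (0 + (\<Sum>y\<in>?N. f r - f (r - 1)))"
    by (intro arg_cong2[where f = "(+)"] sum.cong sum.neutral refl) auto
  finally show ?thesis
    using assms by (simp add: m_plus_eq m_minus_eq r_def)
qed

lemma finite_gball: "finite (gball G c r)"
proof (induction r)
  case 0
  have "gball G c 0 \<subseteq> {c}" using gdist_eq_0_iff by (auto simp: gball_def)
  then show ?case by (rule finite_subset) simp
next
  case (Suc r)
  have "gball G c (Suc r) \<subseteq> {c} \<union> (\<Union>x\<in>gball G c r. {y. adj G x y})"
  proof
    fix x assume x: "x \<in> gball G c (Suc r)"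
    show "x \<in> {c} \<union> (\<Union>x\<in>gball G c r. {y. adj G x y})"
    proof (cases "x = c")
      case False
      then obtain y where "adj G x y" "Suc (gdist G c y) = gdist G c x"
        using predecessor_exists x by (auto simp: gball_def)
      then show ?thesis using x adj_sym adj_verts by (fastforce simp: gball_def)
    qed simp
  qed
  then show ?case using Suc.IH finite_nbrs by (auto intro: finite_subset)
qed

lemma gball_subset_int_gball: "gball G c r \<subseteq> int_gball G c (Suc r)"
  using gdist_adj_le adj_verts by (fastforce simp: gball_def int_gball_def)

lemma int_gball_subset_gball: "int_gball G c r \<subseteq> gball G c r"
  by (auto simp: int_gball_def)

lemma finite_int_gball: "finite (int_gball G c r)"
  using int_gball_subset_gball finite_gball by (rule finite_subset)

lemma finite_subset_gball:
  assumes "finite D" and "D \<subseteq> verts G"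
  obtains r where "D \<subseteq> gball G c r"
proof
  show "D \<subseteq> gball G c (Max (gdist G c ` D))"
    using assms by (auto simp: gball_def)
qed

section \<open>The heat kernel as a supremum\<close>

text \<open>The interiors of the balls increase, so the kernels do; they are bounded by \<open>1\<close>.\<close>

lemma dirichlet_kernel_tendsto:
  assumes "0 \<le> t"
  shows "incseq (\<lambda>r. dirichlet_kernel G c r t x y)"
    and "(\<lambda>r. dirichlet_kernel G c r t x y) \<longlonglongrightarrow> heat_kernel G c t x y"
proof -
  show inc: "incseq (\<lambda>r. dirichlet_kernel G c r t x y)"
    unfolding dirichlet_kernel_eq_killed_kernel
    by (rule incseq_SucI, rule killed_kernel_mono_domain)
      (use assms finite_int_gball int_gball_subset_gball gball_subset_int_gball in blast)+
  have "dirichlet_kernel G c r t x y \<le> 1" for r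
    unfolding dirichlet_kernel_eq_killed_kernel
    by (rule killed_kernel_bounds(2)[OF finite_int_gball assms])
  then show "(\<lambda>r. dirichlet_kernel G c r t x y) \<longlonglongrightarrow> heat_kernel G c t x y"
    unfolding heat_kernel_def
    using incseq_convergent[OF inc, of 1] by (metis limI)
qed

lemma killed_kernel_le_heat_kernel:
  assumes "finite D" and "D \<subseteq> verts G" and "0 \<le> t"
  shows "killed_kernel G D t x y \<le> heat_kernel G c t x y"
proof -
  obtain r where "D \<subseteq> gball G c r" using finite_subset_gball assms by blast
  then have "D \<subseteq> int_gball G c (Suc r)" using gball_subset_int_gball by blast
  then have "killed_kernel G D t x y \<le> dirichlet_kernel G c (Suc r) t x y"
    unfolding dirichlet_kernel_eq_killed_kernel
    by (rule killed_kernel_mono_domain) (use finite_int_gball assms in auto)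
  also have "\<dots> \<le> heat_kernel G c t x y"
    using dirichlet_kernel_tendsto[OF assms(3)] by (rule incseq_le)
  finally show ?thesis .
qed

text \<open>The center of the exhaustion that defines the heat kernel and the center of the balls in
  the hypothesis may differ, since each finite set lies in a large ball about either of them.\<close>

lemma heat_kernel_le:
  assumes "x0 \<in> verts G" and "0 \<le> t"
    and "\<And>R. killed_kernel G (gball G x0 R) t x y \<le> b"
  shows "heat_kernel G c t x y \<le> b"
proof (rule LIMSEQ_le_const2[OF dirichlet_kernel_tendsto(2)[OF assms(2)]], intro exI allI impI)
  fix r
  interpret x0: rooted_graph G x0
    using simple locally_finite connected assms(1) by unfold_locales
  obtain R where "int_gball G c r \<subseteq> gball G x0 R"
    using x0.finite_subset_gball[OF finite_int_gball] by (auto simp: int_gball_def gball_def)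
  then have "dirichlet_kernel G c r t x y \<le> killed_kernel G (gball G x0 R) t x y"
    unfolding dirichlet_kernel_eq_killed_kernel
    by (rule killed_kernel_mono_domain[OF _ x0.finite_gball assms(2)])
  also have "\<dots> \<le> b" by (rule assms(3))
  finally show "dirichlet_kernel G c r t x y \<le> b" .
qed

end

section \<open>Radial comparison\<close>

text \<open>The iterates of \<open>J\<close> for the ball of radius \<open>R\<close> in a tree with branching numbers \<open>n\<close>, as
  functions of the distance to the root. At \<open>r = 0\<close> the truncated \<open>r - 1\<close> makes the inward term
  vanish, as it should at a vertex without predecessor.\<close>

fun radial_iter :: "(nat \<Rightarrow> nat) \<Rightarrow> nat \<Rightarrow> real \<Rightarrow> nat \<Rightarrow> nat \<Rightarrow> real" where
  "radial_iter n R M 0 r = of_bool (r = 0)"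
| "radial_iter n R M (Suc k) r = M * radial_iter n R M k r -
     (if r \<le> R then real (n r) * (radial_iter n R M k r - radial_iter n R M k (Suc r))
        + (radial_iter n R M k r - radial_iter n R M k (r - 1)) else 0)"

lemma radial_iter_outside: "R < r \<Longrightarrow> radial_iter n R M k r = 0"
  by (induction k arbitrary: r) auto

text \<open>The successive differences \<open>w r = u r - u (r + 1)\<close> obey a recursion of their own, with
  coefficients \<open>M - n r - 1\<close> at \<open>w r\<close>, \<open>1\<close> at \<open>w (r - 1)\<close> (for \<open>r > 0\<close>) and \<open>n (r + 1)\<close> at
  \<open>w (r + 1)\<close>. These are nonnegative as soon as \<open>M \<ge> n r + 1\<close>, so the differences stay nonnegative. At \<open>r = R\<close> the
  profile vanishes one step further out, which changes the first coefficient to \<open>M - n R\<close> and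
  drops the last one.\<close>

lemma radial_iter_antimono:
  assumes "\<And>r. r \<le> R \<Longrightarrow> real (n r) + 1 \<le> M"
  shows "radial_iter n R M k (Suc r) \<le> radial_iter n R M k r"
proof (induction k arbitrary: r)
  case 0
  show ?case by simp
next
  case (Suc k)
  define w where "w r = radial_iter n R M k r - radial_iter n R M k (Suc r)" for r
  have w: "0 \<le> w r" for r using Suc.IH by (simp add: w_def)
  have pred: "0 \<le> radial_iter n R M k (r - 1) - radial_iter n R M k r"
    using Suc.IH[of "r - 1"] by (cases r) auto
  consider "r < R" | "r = R" | "R < r" by linarith
  then show ?case
  proof cases
    case 1
    have "radial_iter n R M (Suc k) r - radial_iter n R M (Suc k) (Suc r)
        = (M - real (n r) - 1) * w r + (radial_iter n R M k (r - 1) - radial_iter n R M k r)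
          + real (n (Suc r)) * w (Suc r)"
      using 1 by (simp add: w_def algebra_simps)
    moreover have "0 \<le> (M - real (n r) - 1) * w r" using assms[of r] w 1 by simp
    ultimately show ?thesis using pred w[of "Suc r"] by (smt (verit) mult_nonneg_nonneg of_nat_0_le_iff)
  next
    case 2
    have "radial_iter n R M (Suc k) r - radial_iter n R M (Suc k) (Suc r)
        = (M - real (n r)) * w r + (radial_iter n R M k (r - 1) - radial_iter n R M k r)"
      using 2 by (simp add: w_def radial_iter_outside algebra_simps)
    moreover have "0 \<le> (M - real (n r)) * w r" using assms[of r] w 2 by simp
    ultimately show ?thesis using pred by linarith
  next
    case 3
    then show ?thesis by (simp only: radial_iter_outside less_SucI)
  qed
qed

context rooted_graph
begin

text \<open>The subsolution property. With fewer outward edges than in the tree, less is lost to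
  the smaller values farther out; with at least one inward edge, no less is gained from the
  larger values closer in.\<close>

lemma radial_iter_le_shifted_iter:
  assumes n: "\<And>r. r \<le> R \<Longrightarrow> real (n r) + 1 \<le> M"
    and val: "\<And>z. z \<in> gball G c R \<Longrightarrow> real (valence G z) \<le> M"
    and plus: "\<And>x. x \<in> verts G \<Longrightarrow> m_plus G c x \<le> n (gdist G c x)"
    and "x \<in> verts G"
  shows "radial_iter n R M k (gdist G c x) \<le> shifted_iter G (gball G c R) M c k x"
  using assms(4)
proof (induction k arbitrary: x)
  case 0
  then show ?case by (simp add: shifted_iter_0 gdist_eq_0_iff)
next
  case (Suc k)
  let ?u = "radial_iter n R M k" and ?r = "gdist G c x"
  have M: "0 \<le> M" using n[of 0] by simp
  have "radial_iter n R M (Suc k) ?r \<le> shifted G (gball G c R) M (\<lambda>y. ?u (gdist G c y)) x"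
  proof (cases "?r \<le> R")
    case True
    have "real (m_plus G c x) * (?u ?r - ?u (Suc ?r)) \<le> real (n ?r) * (?u ?r - ?u (Suc ?r))"
      using plus[OF Suc.prems] radial_iter_antimono[where R = R, OF n]
      by (intro mult_right_mono) auto
    moreover have "real (m_minus G c x) * (?u ?r - ?u (?r - 1)) \<le> ?u ?r - ?u (?r - 1)"
    proof (cases "x = c")
      case False
      then have "?r \<noteq> 0" using gdist_eq_0_iff Suc.prems by simp
      then have "?u ?r \<le> ?u (?r - 1)"
        using radial_iter_antimono[where R = R and r = "?r - 1", OF n] by simp
      then show ?thesis
        using m_minus_pos[OF Suc.prems False] mult_right_mono_neg[of 1 "real (m_minus G c x)"] by simp
    qed (simp add: gdist_root)
    moreover have "shifted G (gball G c R) M (\<lambda>y. ?u (gdist G c y)) x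
        = M * ?u ?r - (real (m_plus G c x) * (?u ?r - ?u (Suc ?r))
          + real (m_minus G c x) * (?u ?r - ?u (?r - 1)))"
      using True Suc.prems
      by (simp add: shifted_def killed_laplacian_def gball_def laplacian_radial)
    moreover have "radial_iter n R M (Suc k) ?r
        = M * ?u ?r - (real (n ?r) * (?u ?r - ?u (Suc ?r)) + (?u ?r - ?u (?r - 1)))"
      using True by simp
    ultimately show ?thesis by linarith
  next
    case False
    then show ?thesis
      by (simp add: shifted_def killed_laplacian_def gball_def)
  qed
  also have "\<dots> \<le> shifted G (gball G c R) M (shifted_iter G (gball G c R) M c k) x"
    by (rule shifted_mono) (use val M Suc adj_verts in auto)
  finally show ?case by (simp add: shifted_iter_Suc)
qed

text \<open>The supersolution property. An inward edge raises the iterate, so the number of inward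
  edges must not exceed that of the tree, which is one.\<close>

lemma shifted_iter_le_radial_iter:
  assumes n: "\<And>r. r \<le> R \<Longrightarrow> real (n r) + 1 \<le> M"
    and val: "\<And>z. z \<in> gball G c R \<Longrightarrow> real (valence G z) \<le> M"
    and plus: "\<And>x. x \<in> verts G \<Longrightarrow> n (gdist G c x) \<le> m_plus G c x"
    and minus: "\<And>x. x \<in> verts G \<Longrightarrow> x \<noteq> c \<Longrightarrow> m_minus G c x = 1"
    and "x \<in> verts G"
  shows "shifted_iter G (gball G c R) M c k x \<le> radial_iter n R M k (gdist G c x)"
  using assms(5)
proof (induction k arbitrary: x)
  case 0
  then show ?case by (simp add: shifted_iter_0 gdist_eq_0_iff)
next
  case (Suc k)
  let ?u = "radial_iter n R M k" and ?r = "gdist G c x"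
  have M: "0 \<le> M" using n[of 0] by simp
  have "shifted_iter G (gball G c R) M c (Suc k) x
      \<le> shifted G (gball G c R) M (\<lambda>y. ?u (gdist G c y)) x"
    unfolding shifted_iter_Suc by (rule shifted_mono) (use val M Suc adj_verts in auto)
  also have "\<dots> \<le> radial_iter n R M (Suc k) ?r"
  proof (cases "?r \<le> R")
    case True
    have "real (n ?r) * (?u ?r - ?u (Suc ?r)) \<le> real (m_plus G c x) * (?u ?r - ?u (Suc ?r))"
      using plus[OF Suc.prems] radial_iter_antimono[where R = R, OF n]
      by (intro mult_right_mono) auto
    moreover have "real (m_minus G c x) * (?u ?r - ?u (?r - 1)) = ?u ?r - ?u (?r - 1)"
      using minus[OF Suc.prems] by (cases "x = c") (auto simp: gdist_root)
    moreover have "shifted G (gball G c R) M (\<lambda>y. ?u (gdist G c y)) x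
        = M * ?u ?r - (real (m_plus G c x) * (?u ?r - ?u (Suc ?r))
          + real (m_minus G c x) * (?u ?r - ?u (?r - 1)))"
      using True Suc.prems
      by (simp add: shifted_def killed_laplacian_def gball_def laplacian_radial)
    moreover have "radial_iter n R M (Suc k) ?r
        = M * ?u ?r - (real (n ?r) * (?u ?r - ?u (Suc ?r)) + (?u ?r - ?u (?r - 1)))"
      using True by simp
    ultimately show ?thesis by linarith
  next
    case False
    then show ?thesis
      by (simp add: shifted_def killed_laplacian_def gball_def)
  qed
  finally show ?case .
qed

end

text \<open>The radial profile for \<open>n\<close> separates the two kernels: it is a supersolution on \<open>G\<close> and a
  subsolution on \<open>H\<close>, for balls of the same radius.\<close>

lemma heat_kernel_compare:
  fixes G :: "'a graph" and H :: "'b graph"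
  assumes G: "rooted_graph G a" and H: "rooted_graph H b"
    and "c \<in> verts G" and "d \<in> verts H"
    and G_plus: "\<And>x. x \<in> verts G \<Longrightarrow> n (gdist G a x) \<le> m_plus G a x"
    and G_minus: "\<And>x. x \<in> verts G \<Longrightarrow> x \<noteq> a \<Longrightarrow> m_minus G a x = 1"
    and H_plus: "\<And>x. x \<in> verts H \<Longrightarrow> m_plus H b x \<le> n (gdist H b x)"
    and "x \<in> gsphere G a r" and "y \<in> gsphere H b r" and "0 \<le> t"
  shows "heat_kernel G c t a x \<le> heat_kernel H d t b y"
proof -
  interpret G: rooted_graph G a by fact
  interpret H: rooted_graph H b by fact
  interpret Gc: rooted_graph G c
    using G.simple G.locally_finite G.connected assms(3) by unfold_locales
  interpret Hd: rooted_graph H d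
    using H.simple H.locally_finite H.connected assms(4) by unfold_locales
  have x: "x \<in> verts G" "gdist G a x = r" and y: "y \<in> verts H" "gdist H b y = r"
    using assms(8,9) by (auto simp: gsphere_def)
  show ?thesis
  proof (rule Gc.heat_kernel_le[OF G.root \<open>0 \<le> t\<close>])
    fix R
    let ?D = "gball G a R" and ?E = "gball H b R"
    \<comment> \<open>The series of both kernels and the monotonicity of the profile must use the same \<open>M\<close>.\<close>
    define M where "M = real ((\<Sum>z\<in>?D. valence G z) + (\<Sum>z\<in>?E. valence H z) + (\<Sum>r\<le>R. n r) + 1)"
    have M_G: "real (valence G z) \<le> M" if "z \<in> ?D" for z
    proof -
      have "valence G z \<le> (\<Sum>z\<in>?D. valence G z)"
        using that G.finite_gball by (intro member_le_sum) auto
      then show ?thesis unfolding M_def of_nat_le_iff by linarith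
    qed
    have M_H: "real (valence H z) \<le> M" if "z \<in> ?E" for z
    proof -
      have "valence H z \<le> (\<Sum>z\<in>?E. valence H z)"
        using that H.finite_gball by (intro member_le_sum) auto
      then show ?thesis unfolding M_def of_nat_le_iff by linarith
    qed
    have M_n: "real (n r) + 1 \<le> M" if "r \<le> R" for r
    proof -
      have "n r \<le> (\<Sum>r\<le>R. n r)" using that by (intro member_le_sum) auto
      then have "n r + 1 \<le> (\<Sum>z\<in>?D. valence G z) + (\<Sum>z\<in>?E. valence H z) + (\<Sum>r\<le>R. n r) + 1"
        by linarith
      then show ?thesis unfolding M_def by linarith
    qed
    have "0 \<le> M" using M_n[of 0] by simp
    have iter: "shifted_iter G ?D M a k x \<le> shifted_iter H ?E M b k y" for k
      using G.shifted_iter_le_radial_iter[where R = R and k = k and n = n, OF M_n M_G G_plus G_minus x(1)]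
        H.radial_iter_le_shifted_iter[where R = R and k = k and n = n, OF M_n M_H H_plus y(1)] x y
      by force
    have "killed_kernel G ?D t a x \<le> killed_kernel H ?E t b y"
    proof (cases "r \<le> R")
      case True
      show ?thesis
        by (rule killed_kernel_le[OF M_G M_H \<open>0 \<le> M\<close> \<open>0 \<le> t\<close> _ _ _ _ iter])
          (use True x y G.root H.root in \<open>auto simp: gball_def G.gdist_root H.gdist_root\<close>)
    next
      case False
      then show ?thesis using x y by (simp add: killed_kernel_def gball_def)
    qed
    also have "\<dots> \<le> heat_kernel H d t b y"
      by (rule Hd.killed_kernel_le_heat_kernel)
        (use H.finite_gball \<open>0 \<le> t\<close> in \<open>auto simp: gball_def\<close>)
    finally show "killed_kernel G ?D t a x \<le> heat_kernel H d t b y" .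
  qed
qed

section \<open>Branching of a tree\<close>

text \<open>When a walk returns to a vertex that it has visited, the part in between can be cut out.\<close>

lemma rtranclp_simple_path:
  assumes "R\<^sup>*\<^sup>* a b"
  shows "\<exists>xs. xs \<noteq> [] \<and> distinct xs \<and> successively R xs \<and> hd xs = a \<and> last xs = b"
  using assms
proof (induction rule: rtranclp_induct)
  case base
  show ?case by (rule exI[of _ "[a]"]) simp
next
  case (step b c)
  then obtain xs where xs: "xs \<noteq> []" "distinct xs" "successively R xs" "hd xs = a" "last xs = b"
    by blast
  show ?case
  proof (cases "c \<in> set xs")
    case True
    then obtain ys zs where "xs = (ys @ [c]) @ zs" using split_list[of c xs] by auto
    then have "ys @ [c] \<noteq> [] \<and> distinct (ys @ [c]) \<and> successively R (ys @ [c])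
        \<and> hd (ys @ [c]) = a \<and> last (ys @ [c]) = c"
      using xs by (auto simp: successively_append_iff hd_append)
    then show ?thesis by blast
  next
    case False
    then have "xs @ [c] \<noteq> [] \<and> distinct (xs @ [c]) \<and> successively R (xs @ [c])
        \<and> hd (xs @ [c]) = a \<and> last (xs @ [c]) = c"
      using xs step.hyps by (auto simp: successively_append_iff hd_append)
    then show ?thesis by blast
  qed
qed

locale rooted_tree = rooted_graph +
  assumes acyclic: "\<nexists>xs. is_cycle G xs"
begin

text \<open>Otherwise a simple path from \<open>y\<close> to \<open>z\<close> that avoids \<open>x\<close> closes up through \<open>x\<close> to a cycle.\<close>

lemma nbrs_connected_off_eq:
  assumes "adj G x y" and "adj G x z"
    and "(\<lambda>a b. adj G a b \<and> a \<noteq> x \<and> b \<noteq> x)\<^sup>*\<^sup>* y z"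
  shows "y = z"
proof (rule ccontr)
  let ?R = "\<lambda>a b. adj G a b \<and> a \<noteq> x \<and> b \<noteq> x"
  assume "y \<noteq> z"
  obtain xs where xs: "xs \<noteq> []" "distinct xs" "successively ?R xs" "hd xs = y" "last xs = z"
    using rtranclp_simple_path[OF assms(3)] by blast
  then obtain ys where ys: "xs = y # ys" by (cases xs) auto
  then obtain w ws where ws: "xs = y # w # ws" using xs \<open>y \<noteq> z\<close> by (cases ys) auto
  have "x \<notin> set xs"
  proof
    assume "x \<in> set xs"
    then obtain us vs where split: "xs = us @ x # vs" by (meson split_list)
    show False
    proof (cases vs)
      case Nil
      then show False using split xs assms(2) adj_irrefl by auto
    next
      case (Cons v vs')
      then show False using split xs(3) by (auto simp: successively_append_iff)
    qed
  qed
  moreover have "successively (adj G) xs" using xs(3) by (rule successively_mono) auto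
  ultimately have "is_cycle G (x # xs)"
    using xs ws assms adj_sym by (auto simp: is_cycle_def)
  then show False using acyclic by blast
qed

text \<open>A geodesic from \<open>y\<close> to the root cannot pass through \<open>x\<close>: after \<open>y\<close> it stays strictly
  closer to the root than \<open>x\<close>.\<close>

lemma connected_to_root_off:
  assumes "y \<in> verts G" and "y \<noteq> x" and "gdist G c y \<le> gdist G c x"
  shows "(\<lambda>a b. adj G a b \<and> a \<noteq> x \<and> b \<noteq> x)\<^sup>*\<^sup>* y c"
  using assms
proof (induction "gdist G c y" arbitrary: y)
  case 0
  then show ?case using gdist_eq_0_iff by auto
next
  case (Suc m)
  then have "y \<noteq> c" using gdist_root by auto
  then obtain z where z: "adj G y z" "Suc (gdist G c z) = gdist G c y"
    using predecessor_exists Suc.prems(1) by blast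
  then have "z \<noteq> x" using Suc.prems(3) by auto
  moreover have "(\<lambda>a b. adj G a b \<and> a \<noteq> x \<and> b \<noteq> x)\<^sup>*\<^sup>* z c"
    by (rule Suc.hyps(1)) (use Suc z \<open>z \<noteq> x\<close> adj_verts in auto)
  ultimately show ?case
    using z(1) Suc.prems(2) by (auto intro: converse_rtranclp_into_rtranclp)
qed

text \<open>Two such neighbours would be joined through the root without meeting \<open>x\<close>. This rules out
  both a second predecessor and an edge within a sphere.\<close>

lemma nbr_not_farther_unique:
  assumes "adj G x y" and "adj G x z"
    and "gdist G c y \<le> gdist G c x" and "gdist G c z \<le> gdist G c x"
  shows "y = z"
proof (rule nbrs_connected_off_eq[OF assms(1,2)])
  let ?R = "\<lambda>a b. adj G a b \<and> a \<noteq> x \<and> b \<noteq> x"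
  have "y \<noteq> x" "z \<noteq> x" using assms(1,2) adj_irrefl by auto
  then have y: "?R\<^sup>*\<^sup>* y c" and z: "?R\<^sup>*\<^sup>* z c"
    using assms by (auto intro: connected_to_root_off adj_verts)
  have "symp ?R" using adj_sym by (auto intro: sympI)
  then have "?R\<^sup>*\<^sup>* c z" using z by (rule sympD[OF symp_rtranclp])
  with y show "?R\<^sup>*\<^sup>* y z" by (rule rtranclp_trans)
qed

lemma tree_m_minus:
  assumes "x \<in> verts G" and "x \<noteq> c"
  shows "m_minus G c x = 1"
proof -
  obtain y where y: "adj G x y" "Suc (gdist G c y) = gdist G c x"
    using predecessor_exists[OF assms] .
  then have "{y. adj G x y \<and> Suc (gdist G c y) = gdist G c x} = {y}"
    using nbr_not_farther_unique by fastforce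
  then show ?thesis by (simp add: m_minus_eq[OF assms(1)])
qed

lemma tree_m_plus:
  assumes "x \<in> verts G"
  shows "m_plus G c x = (if x = c then valence G x else valence G x - 1)"
proof (cases "x = c")
  case True
  have "{y. adj G x y \<and> gdist G c y = Suc (gdist G c x)} = {y. adj G x y}"
    using gdist_adj_cases[of x] True adj_irrefl adj_verts gdist_eq_0_iff gdist_root by fastforce
  then show ?thesis using True by (simp add: m_plus_eq valence_def)
next
  case False
  obtain z where z: "adj G x z" "Suc (gdist G c z) = gdist G c x"
    using predecessor_exists[OF assms False] .
  have "{y. adj G x y \<and> gdist G c y = Suc (gdist G c x)} = {y. adj G x y} - {z}"
  proof (rule set_eqI)
    fix y
    have "y = z" if "adj G x y" "gdist G c y \<noteq> Suc (gdist G c x)"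
      by (rule nbr_not_farther_unique[OF that(1) z(1)])
        (use gdist_adj_cases[OF that(1)] that(2) z(2) in linarith)+
    then show "y \<in> {y. adj G x y \<and> gdist G c y = Suc (gdist G c x)} \<longleftrightarrow> y \<in> {y. adj G x y} - {z}"
      using z(2) by auto
  qed
  then show ?thesis
    using False z finite_nbrs by (simp add: m_plus_eq valence_def)
qed

end

lemma rooted_tree_model_tree: "model_tree T x0 \<Longrightarrow> rooted_tree T x0"
  by (simp add: model_tree_def is_tree_def rooted_tree_def rooted_graph_def rooted_tree_axioms_def)

text \<open>Off the root the only neighbour not counted by \<open>m_plus\<close> is the predecessor, which
  accounts for the \<open>- 1\<close> in the branching number.\<close>

lemma model_tree_m_plus:
  assumes "model_tree T x0" and "x \<in> verts T"
  shows "m_plus T x0 x = branching T x0 (gdist T x0 x)"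
proof -
  interpret rooted_tree T x0 using assms(1) by (rule rooted_tree_model_tree)
  show ?thesis
  proof (cases "x = x0")
    case True
    then show ?thesis using assms(2) by (simp add: tree_m_plus branching_def gdist_root)
  next
    case False
    let ?S = "gsphere T x0 (gdist T x0 x)"
    have "\<forall>y\<in>?S. valence T y = valence T x"
    proof
      fix y assume "y \<in> ?S"
      then have y: "y \<in> verts T" "gdist T x0 y = gdist T x0 x" by (auto simp: gsphere_def)
      then have "y \<noteq> x0" using False assms(2) gdist_eq_0_iff[of x] gdist_root by auto
      then show "valence T y = valence T x"
        using assms False y unfolding model_tree_def by blast
    qed
    moreover have "m = valence T x" if "\<forall>y\<in>?S. valence T y = m" for m
    proof -
      have "x \<in> ?S" using assms(2) by (simp add: gsphere_def)
      then have "valence T x = m" by (rule bspec[OF that])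
      then show ?thesis by (rule sym)
    qed
    ultimately have "valence_at T x0 (gdist T x0 x) = valence T x"
      unfolding valence_at_def by (rule the_equality)
    then show ?thesis
      using False assms(2) by (simp add: tree_m_plus branching_def gdist_eq_0_iff)
  qed
qed

theorem theorem3p13:
  fixes T :: "'a graph" and G :: "'b graph"
    and x0 c :: 'a and x0' c' :: 'b
  assumes "model_tree T x0"
    and "simple_graph G" and "infinite (verts G)" and "locally_finite G" and "connected_graph G"
    and "c \<in> verts T" and "c' \<in> verts G"
    and "x0' \<in> verts G"
  shows
    "((\<forall>r. \<forall>x\<in>gsphere G x0' r. m_plus G x0' x \<le> branching T x0 r) \<longrightarrow>
        (\<forall>r. \<forall>x\<in>gsphere G x0' r. \<forall>z\<in>gsphere T x0 r. \<forall>t\<ge>0.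
           heat_kernel T c t x0 z \<le> heat_kernel G c' t x0' x))
     \<and>
     ((\<forall>r. \<forall>x\<in>gsphere G x0' r. branching T x0 r \<le> m_plus G x0' x) \<and>
      (\<forall>r\<ge>1. \<forall>x\<in>gsphere G x0' r. m_minus G x0' x = 1) \<longrightarrow>
        (\<forall>r. \<forall>x\<in>gsphere G x0' r. \<forall>z\<in>gsphere T x0 r. \<forall>t\<ge>0.
           heat_kernel G c' t x0' x \<le> heat_kernel T c t x0 z))"
proof -
  interpret T: rooted_tree T x0 using assms(1) by (rule rooted_tree_model_tree)
  have T: "rooted_graph T x0" by unfold_locales
  have G: "rooted_graph G x0'" using assms by (simp add: rooted_graph_def)
  interpret G: rooted_graph G x0' by fact
  note T_plus = model_tree_m_plus[OF assms(1)]
  have lower: "heat_kernel T c t x0 z \<le> heat_kernel G c' t x0' x"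
    if "\<forall>r. \<forall>x\<in>gsphere G x0' r. m_plus G x0' x \<le> branching T x0 r"
      and "x \<in> gsphere G x0' r" and "z \<in> gsphere T x0 r" and "0 \<le> t" for r x z t
  proof (rule heat_kernel_compare[OF T G assms(6,7) _ T.tree_m_minus _ that(3,2,4)])
    show "branching T x0 (gdist T x0 y) \<le> m_plus T x0 y" if "y \<in> verts T" for y
      using T_plus[OF that] by simp
    show "m_plus G x0' y \<le> branching T x0 (gdist G x0' y)" if "y \<in> verts G" for y
      using \<open>\<forall>r. \<forall>x\<in>gsphere G x0' r. _\<close> that by (simp add: gsphere_def)
  qed
  have upper: "heat_kernel G c' t x0' x \<le> heat_kernel T c t x0 z"
    if plus: "\<forall>r. \<forall>x\<in>gsphere G x0' r. branching T x0 r \<le> m_plus G x0' x"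
      and minus: "\<forall>r\<ge>1. \<forall>x\<in>gsphere G x0' r. m_minus G x0' x = 1"
      and "x \<in> gsphere G x0' r" and "z \<in> gsphere T x0 r" and "0 \<le> t" for r x z t
  proof (rule heat_kernel_compare[OF G T assms(7,6) _ _ _ that(3-5)])
    show "branching T x0 (gdist G x0' y) \<le> m_plus G x0' y" if "y \<in> verts G" for y
      using plus that by (simp add: gsphere_def)
    show "m_minus G x0' y = 1" if "y \<in> verts G" and "y \<noteq> x0'" for y
    proof -
      have "1 \<le> gdist G x0' y" using G.gdist_eq_0_iff[OF that(1)] that(2) by linarith
      moreover have "y \<in> gsphere G x0' (gdist G x0' y)" using that(1) by (simp add: gsphere_def)
      ultimately show ?thesis using minus by blast
    qed
    show "m_plus T x0 y \<le> branching T x0 (gdist T x0 y)" if "y \<in> verts T" for y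
      using T_plus[OF that] by simp
  qed
  from lower upper show ?thesis by blast
qed

end
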